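(* Let $\mathbb{G}$ be a connected (oriented) ribbon graph with Bollobás--Riordan--Tutte polynomial $C(\mathbb{G};X,Y,Z)$, and let $q(\mathbb{G};t,Y)=C(\mathbb{G};1,Y,tY^{-2})$. Then $q(\mathbb{G};t,Y)$ is a polynomial in $t$ and $Y$ such that $$q(\mathbb{G};t,0)=\sum\nolimits_j a_j t^j,$$ where $a_j$ is the number of quasi-trees of $\mathbb{G}$ of genus $j$. Consequently, $q(\mathbb{G};1,0)$ equals the number of quasi-trees of $\mathbb{G}$.
   Context: Ribbon graphs. An (oriented) ribbon graph $\mathbb{G}$ is a multigraph (loops and multiple edges allowed) embedded in a closed oriented surface $S(\mathbb{G})$ so that the complement is a disjoint union of open discs (faces). Combinatorially it is given by permutations $(\sigma_0,\sigma_1,\sigma_2)$ of the set $\{1,\dots,2n\}$ of half-edges, with $\sigma_1$ a fixed-point-free involution and $\sigma_0\sigma_1\sigma_2=1$ (composition right to left); the orbits of $\sigma_0,\sigma_1,\sigma_2$ are the vertices, edges and faces. (A single vertex with no edges is also a ribbon graph, with genus $0$ and one face.) Spanning subgraphs. A spanning subgraph $\mathbb{H}\subseteq\mathbb{G}$ has all vertices of $\mathbb{G}$ and some subset of its edges. Take a regular neighborhood of $\mathbb{H}$ in $S(\mathbb{G})$ (a disc at each vertex, a band along each edge of $\mathbb{H}$), and let $\gamma_{\mathbb{H}}$ be its boundary. Let $v(\mathbb{H}),e(\mathbb{H}),k(\mathbb{H})$ be the numbers of vertices, edges and connected components, $f(\mathbb{H})$ the number of components of $\gamma_{\mathbb{H}}$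 (faces of $\mathbb{H}$), $n(\mathbb{H})=e(\mathbb{H})-v(\mathbb{H})+k(\mathbb{H})$ the nullity, and $g(\mathbb{H})$ the genus, given by $2g(\mathbb{H})=k(\mathbb{H})+n(\mathbb{H})-f(\mathbb{H})$. Combinatorially, $f(\mathbb{H})$ is the number of isolated vertices of $\mathbb{H}$ plus the number of cycles of $\sigma_0'\sigma_1'$, where $\sigma_0'$ (resp. $\sigma_1'$) is the permutation of the half-edges of $\mathbb{H}$ obtained from $\sigma_0$ (resp. $\sigma_1$) by deleting from its cycles all half-edges not in $\mathbb{H}$. Quasi-trees. A quasi-tree $\mathbb{Q}$ of $\mathbb{G}$ is a connected spanning subgraph with $f(\mathbb{Q})=1$; its genus is $g(\mathbb{Q})$. The polynomial. The Bollobás--Riordan--Tutte polynomial is $$C(\mathbb{G};X,Y,Z)=\sum_{\mathbb{H}}(X-1)^{k(\mathbb{H})-k(\mathbb{G})}\,Y^{n(\mathbb{H})}\,Z^{g(\mathbb{H})},$$ summed over all spanning subgraphs $\mathbb{H}$ of $\mathbb{G}$. *)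

theory Defs
  imports
    "HOL-Combinatorics.Orbits"
    "HOL-Combinatorics.Permutations"
    "HOL-Computational_Algebra.Polynomial_Factorial"
begin

text \<open>
  Half-edges are labelled by an arbitrary finite set. A vertex without half-edges does not show up
  as a cycle of \<open>sigma0\<close>, so such vertices are listed separately; the one-vertex ribbon graph without
  edges has \<open>half_edges G = {}\<close> and a singleton \<open>bare_vertices G\<close>.
\<close>

record ('a, 'v) ribbon =
  half_edges :: "'a set"
  sigma0 :: "'a \<Rightarrow> 'a"
  sigma1 :: "'a \<Rightarrow> 'a"
  sigma2 :: "'a \<Rightarrow> 'a"
  bare_vertices :: "'v set"

definition ribbon_graph :: "('a, 'v) ribbon \<Rightarrow> bool" where
  "ribbon_graph G \<longleftrightarrow>
     finite (half_edges G) \<and> finite (bare_vertices G) \<and>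
     sigma0 G permutes half_edges G \<and>
     sigma1 G permutes half_edges G \<and>
     sigma2 G permutes half_edges G \<and>
     (\<forall>h\<in>half_edges G. sigma1 G h \<noteq> h \<and> sigma1 G (sigma1 G h) = h) \<and>
     sigma0 G \<circ> sigma1 G \<circ> sigma2 G = id"

definition cycles_on :: "('a \<Rightarrow> 'a) \<Rightarrow> 'a set \<Rightarrow> 'a set set" where
  "cycles_on \<pi> D = orbit \<pi> ` D"

definition vertices :: "('a, 'v) ribbon \<Rightarrow> ('a set + 'v) set" where
  "vertices G = cycles_on (sigma0 G) (half_edges G) <+> bare_vertices G"

definition edges :: "('a, 'v) ribbon \<Rightarrow> 'a set set" where
  "edges G = cycles_on (sigma1 G) (half_edges G)"

definition half_edges_at :: "'a set + 'v \<Rightarrow> 'a set" where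
  "half_edges_at v = (case v of Inl c \<Rightarrow> c | Inr _ \<Rightarrow> {})"

text \<open>
  A spanning subgraph of \<open>G\<close> has all vertices of \<open>G\<close>, so it is given by its edge set
  \<open>A \<subseteq> edges G\<close>; its half-edges are \<open>\<Union>A\<close>.
\<close>

definition adjacency :: "('a, 'v) ribbon \<Rightarrow> 'a set set \<Rightarrow> (('a set + 'v) \<times> ('a set + 'v)) set" where
  "adjacency G A = {(u, w). u \<in> vertices G \<and> w \<in> vertices G \<and>
     (\<exists>h\<in>\<Union>A. h \<in> half_edges_at u \<and> sigma1 G h \<in> half_edges_at w)}"

text \<open>
  The adjacency relation is symmetric because \<open>sigma1\<close> is an involution, so its reflexive transitive
  closure is connectedness in the subgraph.
\<close>

definition components :: "('a, 'v) ribbon \<Rightarrow> 'a set set \<Rightarrow> ('a set + 'v) set set" where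
  "components G A = vertices G // (adjacency G A)\<^sup>*"

definition isolated_vertices :: "('a, 'v) ribbon \<Rightarrow> 'a set set \<Rightarrow> ('a set + 'v) set" where
  "isolated_vertices G A = {v \<in> vertices G. half_edges_at v \<inter> \<Union>A = {}}"

text \<open>
  Deleting from the cycles of \<open>\<pi>\<close> all elements outside \<open>D\<close>: an element of \<open>D\<close> is sent to the
  next element of \<open>D\<close> on its cycle.
\<close>

definition delete_outside :: "('a \<Rightarrow> 'a) \<Rightarrow> 'a set \<Rightarrow> 'a \<Rightarrow> 'a" where
  "delete_outside \<pi> D h =
     (if h \<in> D then (\<pi> ^^ (LEAST m. 0 < m \<and> (\<pi> ^^ m) h \<in> D)) h else h)"

definition num_vertices :: "('a, 'v) ribbon \<Rightarrow> nat" where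
  "num_vertices G = card (vertices G)"

definition num_components :: "('a, 'v) ribbon \<Rightarrow> 'a set set \<Rightarrow> nat" where
  "num_components G A = card (components G A)"

definition num_faces :: "('a, 'v) ribbon \<Rightarrow> 'a set set \<Rightarrow> nat" where
  "num_faces G A = card (isolated_vertices G A) +
     card (cycles_on (delete_outside (sigma0 G) (\<Union>A) \<circ> delete_outside (sigma1 G) (\<Union>A)) (\<Union>A))"

definition nullity :: "('a, 'v) ribbon \<Rightarrow> 'a set set \<Rightarrow> int" where
  "nullity G A = int (card A) - int (num_vertices G) + int (num_components G A)"

text \<open>By Euler's formula the dividend below is even and nonnegative, so the division is exact.\<close>

definition genus :: "('a, 'v) ribbon \<Rightarrow> 'a set set \<Rightarrow> int" where
  "genus G A = (int (num_components G A) + nullity G A - int (num_faces G A)) div 2"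

definition connected_ribbon_graph :: "('a, 'v) ribbon \<Rightarrow> bool" where
  "connected_ribbon_graph G \<longleftrightarrow> ribbon_graph G \<and> num_components G (edges G) = 1"

definition quasi_trees :: "('a, 'v) ribbon \<Rightarrow> 'a set set set" where
  "quasi_trees G = {A. A \<subseteq> edges G \<and> num_components G A = 1 \<and> num_faces G A = 1}"

definition num_quasi_trees_of_genus :: "('a, 'v) ribbon \<Rightarrow> nat \<Rightarrow> nat" where
  "num_quasi_trees_of_genus G j = card {A \<in> quasi_trees G. genus G A = int j}"

text \<open>
  Integer polynomials in \<open>X\<close>, \<open>Y\<close>, \<open>Z\<close> are elements of \<open>\<int>[X][Y][Z]\<close>, with \<open>Z\<close> the outermost
  variable.
\<close>

definition var_X :: "int poly poly poly" where "var_X = [:[:[:0, 1:]:]:]"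
definition var_Y :: "int poly poly poly" where "var_Y = [:[:0, 1:]:]"
definition var_Z :: "int poly poly poly" where "var_Z = [:0, 1:]"

text \<open>
  All three exponents are nonnegative integers for a ribbon graph, so \<open>nat\<close> does not truncate.
\<close>

definition BRT_polynomial :: "('a, 'v) ribbon \<Rightarrow> int poly poly poly" where
  "BRT_polynomial G = (\<Sum>A\<in>Pow (edges G).
     (var_X - 1) ^ nat (int (num_components G A) - int (num_components G (edges G))) *
     var_Y ^ nat (nullity G A) * var_Z ^ nat (genus G A))"

definition substitute3 :: "int poly poly poly \<Rightarrow> 'r \<Rightarrow> 'r \<Rightarrow> 'r \<Rightarrow> 'r::comm_ring_1" where
  "substitute3 p x y z =
     poly (map_poly (\<lambda>b. poly (map_poly (\<lambda>a. poly (map_poly of_int a) x) b) y) p) z"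

text \<open>
  Here \<open>\<int>[t][Y]\<close> is \<^typ>\<open>int poly poly\<close>, with \<open>Y\<close> the outer variable. Since \<open>Y\<^sup>-\<^sup>2\<close> is not a
  polynomial, \<open>q\<close> is an element of the field of fractions of \<open>\<int>[t][Y]\<close>.
\<close>

definition q_function :: "('a, 'v) ribbon \<Rightarrow> int poly poly fract" where
  "q_function G =
     (let t = to_fract [:[:0, 1:]:]; Y = to_fract [:0, 1:]
      in substitute3 (BRT_polynomial G) 1 Y (t * inverse (Y ^ 2)))"

end

theory Submission
  imports Defs
begin

text \<open>
  A connected \<open>A\<close> contributes \<open>t\<^sup>g Y\<^sup>m\<close> with \<open>m = n - 2g = f - 1\<close>, and the other terms vanish
  at \<open>X = 1\<close>, so at \<open>Y = 0\<close> exactly the quasi-trees survive. The point is Euler's formula,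
  that \<open>2k + e - v - f\<close> is even and nonnegative. The faces of \<open>A\<close> are the cycles, on all half-edges, of
  \<open>sigma0 \<circ> \<tau>\<close> where \<open>\<tau>\<close> swaps the ends of the edges in \<open>A\<close>, together with the bare vertices.
  Adding an edge composes this permutation with a transposition, which merges or splits cycles.
\<close>

section \<open>Components of a graph under insertion of one edge\<close>

text \<open>If \<open>u\<close> and \<open>w\<close> are already linked, the closure does not
  change; otherwise their two classes fuse into one and every other class survives. It serves twice:
  for components of subgraphs and, with the graph of a permutation, for cycles.\<close>

lemma card_quotient_insert_edge:
  assumes fin: "finite V" and sym: "sym r" and u: "u \<in> V" and w: "w \<in> V"
  shows "card (V // (r \<union> {(u, w), (w, u)})\<^sup>*) + (if (u, w) \<in> r\<^sup>* then 0 else 1) = card (V // r\<^sup>*)"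
    (is "card (V // ?R'\<^sup>*) + _ = _")
proof (cases "(u, w) \<in> r\<^sup>*")
  case True
  then have "(w, u) \<in> r\<^sup>*"
    using sym by (meson sym_rtrancl symE)
  with True have "?R'\<^sup>* = r\<^sup>*"
    by (intro rtrancl_subset) auto
  with True show ?thesis by simp
next
  case False
  define R where "R = r\<^sup>*"
  have symR: "(x, y) \<in> R \<Longrightarrow> (y, x) \<in> R" for x y
    using sym unfolding R_def by (meson sym_rtrancl symE)
  have reflR: "(x, x) \<in> R" for x
    by (simp add: R_def)
  have transR: "(x, y) \<in> R \<Longrightarrow> (y, z) \<in> R \<Longrightarrow> (x, z) \<in> R" for x y z
    unfolding R_def by (rule rtrancl_trans)
  have uw: "(u, w) \<notin> R" "(w, u) \<notin> R"
    using False symR by (auto simp: R_def)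
  \<comment> \<open>The fused class. The next goal shows that the new relation has class
    \<open>M\<close> on \<open>M\<close> and the old classes elsewhere.\<close>
  define M where "M = R `` {u} \<union> R `` {w}"
  have M_closed: "y \<in> M \<Longrightarrow> (y, z) \<in> R \<Longrightarrow> z \<in> M" for y z
    using transR by (auto simp: M_def)
  have cls: "?R'\<^sup>* `` {x} = (if x \<in> M then M else R `` {x})" for x
  proof -
    have "(x, y) \<in> ?R'\<^sup>* \<Longrightarrow> y \<in> (if x \<in> M then M else R `` {x})" for y
    proof (induction rule: rtrancl_induct)
      case base
      then show ?case by (auto simp: reflR)
    next
      case (step y z)
      from step(2) have "(y, z) \<in> R \<or> (y \<in> M \<and> z \<in> M)"
        by (auto simp: M_def reflR R_def)
      then show ?case
      proof
        assume yz: "(y, z) \<in> R"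
        show ?thesis
        proof (cases "x \<in> M")
          case True
          with step(3) have "y \<in> M" by simp
          with M_closed[OF this yz] True show ?thesis by simp
        next
          case False
          with step(3) have "(x, y) \<in> R" by simp
          with transR[OF this yz] False show ?thesis by simp
        qed
      next
        assume yz: "y \<in> M \<and> z \<in> M"
        have "x \<in> M"
        proof (rule ccontr)
          assume "x \<notin> M"
          with step(3) have "(y, x) \<in> R" using symR by simp
          with yz M_closed \<open>x \<notin> M\<close> show False by blast
        qed
        with yz show ?thesis by simp
      qed
    qed
    moreover have "(x, y) \<in> ?R'\<^sup>*" if "y \<in> (if x \<in> M then M else R `` {x})" for y
    proof -
      have sub: "R \<subseteq> ?R'\<^sup>*"
        unfolding R_def by (intro rtrancl_mono) auto
      show ?thesis
      proof (cases "(x, y) \<in> R")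
        case False
        with that have "x \<in> M" "y \<in> M" by (auto split: if_splits)
        \<comment> \<open>Both points lie in \<open>M\<close> but are not related by
          \<open>R\<close>, so they lie in different halves, and a path between them crosses the new
          edge once, from \<open>p\<close> to \<open>q\<close>.\<close>
        with False obtain p q where pq: "(x, p) \<in> R" "(q, y) \<in> R" "(p, q) \<in> {(u, w), (w, u)}"
          unfolding M_def using symR[of u x] symR[of w x] transR[of x u y] transR[of x w y] by blast
        from pq(3) have "(p, q) \<in> ?R'" by blast
        with pq(1,2) sub show ?thesis
          by (meson r_into_rtrancl rtrancl_trans subsetD)
      qed (use sub in auto)
    qed
    ultimately show ?thesis by blast
  qed
  define Q where "Q = ?R'\<^sup>*"
  note cls = cls[folded Q_def]
  have *: "x \<in> M \<Longrightarrow> R `` {x} = R `` {u} \<or> R `` {x} = R `` {w}" for x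
    unfolding M_def using symR transR by blast
  have "V // Q = insert M (V // R - {R `` {u}, R `` {w}})"
  proof (intro set_eqI iffI)
    fix C assume "C \<in> V // Q"
    then obtain x where x: "x \<in> V" "C = Q `` {x}" by (auto elim: quotientE)
    show "C \<in> insert M (V // R - {R `` {u}, R `` {w}})"
    proof (cases "x \<in> M")
      case False
      then have "R `` {x} \<noteq> R `` {u}" "R `` {x} \<noteq> R `` {w}"
        using reflR by (auto simp: M_def)
      moreover have "C = R `` {x}" using False x by (simp add: cls)
      ultimately show ?thesis using quotientI[OF x(1), of R] by simp
    next
      case True
      with x show ?thesis by (simp add: cls)
    qed
  next
    fix C assume C: "C \<in> insert M (V // R - {R `` {u}, R `` {w}})"
    show "C \<in> V // Q"
    proof (cases "C = M")
      case True
      have "u \<in> M" using reflR by (auto simp: M_def)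
      then have "M = Q `` {u}" by (simp add: cls)
      then show ?thesis unfolding True using u by (metis quotientI)
    next
      case False
      with C have CR: "C \<in> V // R" "C \<noteq> R `` {u}" "C \<noteq> R `` {w}" by auto
      then obtain x where x: "x \<in> V" "C = R `` {x}" by (auto elim: quotientE)
      then have "C = Q `` {x}" using * CR by (auto simp: cls)
      with x show ?thesis by (metis quotientI)
    qed
  qed
  moreover have "M \<notin> V // R"
  proof
    assume "M \<in> V // R"
    then obtain x where "M = R `` {x}" by (auto elim: quotientE)
    moreover have "u \<in> M" "w \<in> M" using reflR by (auto simp: M_def)
    ultimately have "(x, u) \<in> R" "(x, w) \<in> R" by auto
    with uw transR[OF symR] show False by blast
  qed
  moreover have finQ: "finite (V // R)"
    by (auto simp: quotient_def fin)
  moreover have "R `` {u} \<in> V // R" "R `` {w} \<in> V // R"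
    using u w by (simp_all add: quotientI)
  moreover have "R `` {u} \<noteq> R `` {w}"
    using uw reflR by blast
  \<comment> \<open>Two distinct classes are removed and \<open>M\<close>, which is not an old
    class, is added. The bound by 2 keeps the natural subtraction exact.\<close>
  ultimately have "card (V // Q) = Suc (card (V // R) - 2)" "card (V // R) \<ge> 2"
    using card_mono[of "V // R" "{R `` {u}, R `` {w}}"]
    by (auto simp: card_Diff_subset)
  then show ?thesis using False by (simp only: R_def[symmetric] Q_def[symmetric]) simp
qed

section \<open>Cycles of a permutation composed with a transposition\<close>

text \<open>The undirected functional graph of \<pi>. Its components are the cycles, so counting
  cycles becomes counting components.\<close>

definition step_edges :: "('a \<Rightarrow> 'a) \<Rightarrow> 'a set \<Rightarrow> ('a \<times> 'a) set" where
  "step_edges \<pi> H = {(x, y). x \<in> H \<and> y \<in> H \<and> (y = \<pi> x \<or> x = \<pi> y)}"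

lemma sym_step_edges: "sym (step_edges \<pi> H)"
  by (auto simp: sym_def step_edges_def)

lemma step_edgesI: "\<pi> permutes H \<Longrightarrow> x \<in> H \<Longrightarrow> (x, \<pi> x) \<in> step_edges \<pi> H"
  by (simp add: step_edges_def permutes_in_image)

lemma step_edges_Image:
  assumes \<pi>: "\<pi> permutes H" and fin: "finite H" and x: "x \<in> H"
  shows "(step_edges \<pi> H)\<^sup>* `` {x} = orbit \<pi> x"
proof -
  have perm: "permutation \<pi>" using \<pi> fin permutation_permutes by blast
  have "(x, y) \<in> (step_edges \<pi> H)\<^sup>* \<Longrightarrow> y \<in> orbit \<pi> x" for y
  proof (induction rule: rtrancl_induct)
    case base
    show ?case using perm by (rule permutation_self_in_orbit)
  next
    case (step y z)
    then consider "z = \<pi> y" | "y = \<pi> z" by (auto simp: step_edges_def)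
    then show ?case
    proof cases
      case 1
      with step show ?thesis by (auto intro: orbit.step)
    next
      case 2
      have "z \<in> orbit \<pi> y"
        unfolding 2 permutation_orbit_step[OF perm] using perm by (rule permutation_self_in_orbit)
      then show ?thesis using step(3) by (rule orbit_trans)
    qed
  qed
  moreover have "y \<in> H \<and> (x, y) \<in> (step_edges \<pi> H)\<^sup>*" if "y \<in> orbit \<pi> x" for y
    using that
  proof induction
    case base
    then show ?case using step_edgesI[OF \<pi> x] by (auto simp: step_edges_def)
  next
    case (step y)
    then show ?case
      using step_edgesI[OF \<pi>, of y] permutes_in_image[OF \<pi>, of y] by (auto intro: rtrancl_into_rtrancl)
  qed
  ultimately show ?thesis by blast
qed

lemma cycles_on_eq_quotient:
  assumes "\<pi> permutes H" "finite H"
  shows "cycles_on \<pi> H = H // (step_edges \<pi> H)\<^sup>*"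
  using step_edges_Image[OF assms] by (auto simp: cycles_on_def quotient_def)

text \<open>Follow \<pi> from \<open>b\<close> until it first hits \<open>a\<close>. The points met
  after \<open>b\<close>, up to and including \<open>a\<close>, are closed under the new
  permutation, which sends \<open>a\<close> to \<open>\<pi> b\<close>, and \<open>b\<close> is not
  among them.\<close>

lemma orbit_transpose_split:
  assumes perm: "permutation \<pi>" and ab: "a \<noteq> b" and b: "b \<in> orbit \<pi> a"
  shows "b \<notin> orbit (\<pi> \<circ> transpose a b) a"
proof -
  define P where "P m \<longleftrightarrow> 0 < m \<and> (\<pi> ^^ m) b = a" for m
  have "a \<in> orbit \<pi> b"
    using b perm by (meson orbit_swap permutation_self_in_orbit)
  then have "\<exists>m. P m" by (auto simp: P_def orbit_altdef)
  define m where "m = (LEAST m. P m)"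
  have m: "0 < m" "(\<pi> ^^ m) b = a"
    using LeastI_ex[OF \<open>\<exists>m. P m\<close>] by (auto simp: m_def P_def)
  have least: "(\<pi> ^^ i) b \<noteq> a" if "0 < i" "i < m" for i
    using that not_less_Least[of i P] by (auto simp: m_def P_def)
  define S where "S = (\<lambda>i. (\<pi> ^^ i) b) ` {1..m}"
  \<comment> \<open>A return to \<open>b\<close> after \<open>i < m\<close> steps would let \<pi>
    reach \<open>a\<close> from \<open>b\<close> in \<open>m - i\<close> steps, against the
    minimality of \<open>m\<close>.\<close>
  have "(\<pi> ^^ i) b \<noteq> b" if "i \<in> {1..m}" for i
  proof
    assume i: "(\<pi> ^^ i) b = b"
    then have "i < m" using that m ab by (cases "i = m") auto
    then have "(\<pi> ^^ m) b = (\<pi> ^^ (m - i)) ((\<pi> ^^ i) b)"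
      by (metis add.commute comp_apply funpow_add le_add_diff_inverse less_imp_le)
    then have "(\<pi> ^^ (m - i)) b = a" using i m by simp
    with least[of "m - i"] \<open>i < m\<close> that show False by auto
  qed
  then have bS: "b \<notin> S" unfolding S_def by (metis imageE)
  have "(\<pi> ^^ 1) b \<in> S" unfolding S_def using m by (intro imageI) auto
  then have \<pi>b: "\<pi> b \<in> S" by simp
  have closed: "(\<pi> \<circ> transpose a b) x \<in> S" if "x \<in> S" for x
  proof (cases "x = a")
    case True
    then show ?thesis using \<pi>b by simp
  next
    case False
    from that obtain i where i: "i \<in> {1..m}" "x = (\<pi> ^^ i) b" by (auto simp: S_def)
    with False m have "i \<noteq> m" by auto
    with i have "Suc i \<in> {1..m}" by auto
    then have "(\<pi> ^^ Suc i) b \<in> S" unfolding S_def by (rule imageI)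
    moreover have "x \<noteq> b" using bS that by auto
    ultimately show ?thesis using False i by simp
  qed
  have "y \<in> S" if "y \<in> orbit (\<pi> \<circ> transpose a b) a" for y
    using that by induction (use \<pi>b closed in auto)
  with bS show ?thesis by blast
qed

text \<open>The new permutation sends \<open>a\<close> to \<open>\<pi> b\<close> and then runs along
  the \<pi>-cycle of \<open>b\<close>. That cycle avoids \<open>a\<close>, so nothing diverts the
  walk before it arrives at \<open>b\<close>.\<close>

lemma orbit_transpose_merge:
  assumes perm: "permutation \<pi>" and b: "b \<notin> orbit \<pi> a"
  shows "b \<in> orbit (\<pi> \<circ> transpose a b) a"
proof (rule ccontr)
  assume nb: "b \<notin> orbit (\<pi> \<circ> transpose a b) a"
  have "x \<in> orbit (\<pi> \<circ> transpose a b) a" if "x \<in> orbit \<pi> b" for x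
    using that
  proof induction
    case base
    show ?case using orbit.base[of "\<pi> \<circ> transpose a b" a] by (metis comp_apply transpose_apply_first)
  next
    case (step y)
    have "y \<noteq> a"
      using step(1) b perm by (metis orbit_swap permutation_self_in_orbit)
    moreover have "y \<noteq> b" using step nb by blast
    ultimately show ?case
      using orbit.step[OF step(2)] by (metis comp_apply transpose_apply_other)
  qed
  then show False using nb permutation_self_in_orbit[OF perm, of b] by blast
qed

text \<open>Once the edge between \<open>a\<close> and \<open>b\<close> is added, the graphs of
  \<pi> and of the composite have the same components. Exactly one of the two permutations has
  \<open>a\<close> and \<open>b\<close> on a common cycle, and the other has one cycle more than
  there are such components.\<close>

lemma card_cycles_on_transpose:
  assumes \<pi>: "\<pi> permutes H" and fin: "finite H" and a: "a \<in> H" and b: "b \<in> H" and ab: "a \<noteq> b"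
  shows "int (card (cycles_on (\<pi> \<circ> transpose a b) H)) =
         int (card (cycles_on \<pi> H)) + (if b \<in> orbit \<pi> a then 1 else - 1)"
proof -
  let ?\<pi>' = "\<pi> \<circ> transpose a b"
  let ?e = "{(a, b), (b, a)}"
  have perm: "permutation \<pi>" using \<pi> fin permutation_permutes by blast
  have \<pi>': "?\<pi>' permutes H"
    using \<pi> a b by (simp add: permutes_compose permutes_swap_id)
  have sub: "step_edges \<rho>' H \<subseteq> (step_edges \<rho> H \<union> ?e)\<^sup>*"
    if \<rho>: "\<rho> permutes H" "\<rho>' = \<rho> \<circ> transpose a b" for \<rho> \<rho>'
  proof -
    let ?R = "(step_edges \<rho> H \<union> ?e)\<^sup>*"
    have sym: "sym ?R"
      by (intro sym_rtrancl sym_Un sym_step_edges) (auto simp: sym_def)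
    have *: "(x, \<rho>' x) \<in> ?R" if "x \<in> H" for x
    proof -
      have step: "(y, \<rho> y) \<in> ?R" if "y \<in> H" for y
        using step_edgesI[OF \<rho>(1) that] by blast
      consider "x = a" | "x = b" "x \<noteq> a" | "x \<noteq> a" "x \<noteq> b" by blast
      then show ?thesis
      proof cases
        case 1
        have "(a, b) \<in> ?R" by blast
        from rtrancl_trans[OF this step[OF b]] show ?thesis using 1 \<rho> by simp
      next
        case 2
        have "(b, a) \<in> ?R" by blast
        from rtrancl_trans[OF this step[OF a]] show ?thesis using 2 \<rho> by simp
      next
        case 3
        then show ?thesis using step[OF that] \<rho> by simp
      qed
    qed
    then show ?thesis using symD[OF sym] by (auto simp: step_edges_def)
  qed
  have "step_edges ?\<pi>' H \<union> ?e \<subseteq> (step_edges \<pi> H \<union> ?e)\<^sup>*"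
    using sub[OF \<pi> refl] by auto
  \<comment> \<open>Composing with the transposition twice gives back \<pi>, so the roles can be
    exchanged.\<close>
  moreover have "step_edges \<pi> H \<union> ?e \<subseteq> (step_edges ?\<pi>' H \<union> ?e)\<^sup>*"
    using sub[OF \<pi>', of \<pi>] by (auto simp: comp_assoc)
  ultimately have "(step_edges ?\<pi>' H \<union> ?e)\<^sup>* = (step_edges \<pi> H \<union> ?e)\<^sup>*"
    by (metis rtrancl_subset_rtrancl subset_antisym)
  moreover have "card (H // (step_edges \<rho> H \<union> ?e)\<^sup>*) + (if b \<in> orbit \<rho> a then 0 else 1) =
      card (cycles_on \<rho> H)" if \<rho>: "\<rho> permutes H" for \<rho>
  proof -
    have "(a, b) \<in> (step_edges \<rho> H)\<^sup>* \<longleftrightarrow> b \<in> orbit \<rho> a"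
      using step_edges_Image[OF \<rho> fin a] by blast
    with card_quotient_insert_edge[OF fin sym_step_edges a b, of \<rho> H] show ?thesis
      by (simp only: cycles_on_eq_quotient[OF \<rho> fin])
  qed
  from this[OF \<pi>] this[OF \<pi>'] calculation
  show ?thesis
    using orbit_transpose_split[OF perm ab] orbit_transpose_merge[OF perm, of b a]
    by (auto simp only: split: if_splits)
qed

section \<open>Deletion from cycles as a first return map\<close>

text \<open>From a point \<open>x\<close> of \<open>D\<close>, iterating \<pi> runs through the
  \<sigma>-iterates of \<open>\<tau> x\<close> until \<open>D\<close> is met again, and that point
  is the image of \<open>x\<close> under the composite on the left. So this composite is the first
  return map of \<pi> to \<open>D\<close>, and its orbit is the trace of the \<pi>-orbit.\<close>

lemma orbit_delete_outside:
  assumes \<sigma>: "permutation \<sigma>" and \<tau>: "\<And>x. x \<in> D \<Longrightarrow> \<tau> x \<in> D" and h: "h \<in> D"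
  defines "\<pi> \<equiv> \<lambda>x. \<sigma> (if x \<in> D then \<tau> x else x)"
  shows "orbit (delete_outside \<sigma> D \<circ> \<tau>) h = orbit \<pi> h \<inter> D"
proof -
  define F where "F = delete_outside \<sigma> D \<circ> \<tau>"
  define m where "m y = (LEAST m. 0 < m \<and> (\<sigma> ^^ m) y \<in> D)" for y
  have m: "0 < m y \<and> (\<sigma> ^^ m y) y \<in> D" if "y \<in> D" for y
  proof -
    obtain n where "(\<sigma> ^^ n) y = y" "0 < n"
      using permutation_self[OF \<sigma>] by metis
    with that have "\<exists>n. 0 < n \<and> (\<sigma> ^^ n) y \<in> D" by auto
    then show ?thesis unfolding m_def by (rule LeastI_ex)
  qed
  have before: "(\<sigma> ^^ i) y \<notin> D" if "0 < i" "i < m y" for i y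
    using that not_less_Least[of i "\<lambda>m. 0 < m \<and> (\<sigma> ^^ m) y \<in> D"] by (auto simp: m_def)
  have F: "F x = (\<sigma> ^^ m (\<tau> x)) (\<tau> x)" if "x \<in> D" for x
    using \<tau>[OF that] by (simp add: F_def delete_outside_def m_def)
  have FD: "F x \<in> D" if "x \<in> D" for x
    using m[OF \<tau>[OF that]] F[OF that] by simp
  have OD: "y \<in> D" if "y \<in> orbit F x" "x \<in> D" for x y
    using that by induction (auto intro: FD)
  have path: "(\<sigma> ^^ Suc j) (\<tau> x) \<in> orbit \<pi> x" if "x \<in> D" "Suc j \<le> m (\<tau> x)" for x j
    using that(2)
  proof (induction j)
    case 0
    then show ?case using orbit.base[of \<pi> x] that(1) by (simp add: \<pi>_def)
  next
    case (Suc j)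
    then have "(\<sigma> ^^ Suc j) (\<tau> x) \<notin> D" by (intro before) auto
    then show ?case
      using orbit.step[OF Suc.IH] Suc.prems by (simp add: \<pi>_def)
  qed
  have F_orbit: "F x \<in> orbit \<pi> x" if "x \<in> D" for x
    using path[OF that, of "m (\<tau> x) - 1"] m[OF \<tau>[OF that]] F[OF that] by simp
  have "y \<in> orbit \<pi> h" if "y \<in> orbit F h" for y
    using that
  proof induction
    case (step y)
    then show ?case using F_orbit OD[OF _ h] orbit_trans by fast
  qed (rule F_orbit[OF h])
  \<comment> \<open>Invariant: each point of the \<pi>-orbit lies on the stretch between some
    \<open>y\<close> and its return \<open>F y\<close>. The start \<open>h\<close> is inserted
    because \<open>orbit F h\<close> begins at \<open>F h\<close> and may miss \<open>h\<close> when
    \<open>F\<close> is not injective.\<close>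
  moreover have "\<exists>y\<in>insert h (orbit F h). \<exists>j. 0 < j \<and> j \<le> m (\<tau> y) \<and> x = (\<sigma> ^^ j) (\<tau> y)"
    if "x \<in> orbit \<pi> h" for x
    using that
  proof induction
    case base
    then show ?case
      using m[OF \<tau>[OF h]] h by (intro bexI[of _ h] exI[of _ 1]) (auto simp: \<pi>_def)
  next
    case (step x)
    then obtain y j where y: "y \<in> insert h (orbit F h)"
      and j: "0 < j" "j \<le> m (\<tau> y)" "x = (\<sigma> ^^ j) (\<tau> y)" by blast
    from y have yD: "y \<in> D" using h OD by auto
    show ?case
    proof (cases "j = m (\<tau> y)")
      case True
      with j have x: "x = F y" using F[OF yD] by simp
      then have "x \<in> orbit F h" using y by (auto intro: orbit.intros)
      moreover have "x \<in> D" using x FD[OF yD] by simp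
      ultimately show ?thesis
        using m[OF \<tau>[OF \<open>x \<in> D\<close>]] by (intro bexI[of _ x] exI[of _ 1]) (auto simp: \<pi>_def)
    next
      case False
      then have "x \<notin> D" unfolding j(3) using j by (intro before) auto
      then show ?thesis
        using y j False by (intro bexI[of _ y] exI[of _ "Suc j"]) (auto simp: \<pi>_def)
    qed
  qed
  then have "x \<in> orbit F h" if "x \<in> orbit \<pi> h" "x \<in> D" for x
  proof -
    from that(1) obtain y j where y: "y \<in> insert h (orbit F h)"
      and j: "0 < j" "j \<le> m (\<tau> y)" "x = (\<sigma> ^^ j) (\<tau> y)"
      using \<open>\<And>x. x \<in> orbit \<pi> h \<Longrightarrow> _\<close> by blast
    from y have yD: "y \<in> D" using h OD by auto
    have "j = m (\<tau> y)" using before[OF j(1)] that(2) j by (metis le_neq_implies_less)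
    then have "x = F y" using F[OF yD] j by simp
    then show ?thesis using y by (auto intro: orbit.intros)
  qed
  ultimately show ?thesis using OD[OF _ h] unfolding F_def[symmetric] by blast
qed

section \<open>Faces and components of spanning subgraphs\<close>

text \<open>It acts on all half-edges, whatever \<open>A\<close> is, so the permutations of
  different subgraphs can be compared on one set.\<close>

definition face_perm :: "('a, 'v) ribbon \<Rightarrow> 'a set set \<Rightarrow> 'a \<Rightarrow> 'a" where
  "face_perm G A x = sigma0 G (if x \<in> \<Union>A then sigma1 G x else x)"

definition vertex_of :: "('a, 'v) ribbon \<Rightarrow> 'a \<Rightarrow> 'a set + 'v" where
  "vertex_of G h = Inl (orbit (sigma0 G) h)"

context
  fixes G :: "('a, 'v) ribbon"
  assumes ribbon: "ribbon_graph G"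
begin

lemma finite_half_edges: "finite (half_edges G)"
  and sigma0_permutes: "sigma0 G permutes half_edges G"
  and sigma1_permutes: "sigma1 G permutes half_edges G"
  and sigma1_neq: "h \<in> half_edges G \<Longrightarrow> sigma1 G h \<noteq> h"
  and sigma1_sigma1: "h \<in> half_edges G \<Longrightarrow> sigma1 G (sigma1 G h) = h"
  and sigma1_in: "h \<in> half_edges G \<Longrightarrow> sigma1 G h \<in> half_edges G"
  using ribbon permutes_in_image[of "sigma1 G" "half_edges G"] by (auto simp: ribbon_graph_def)

lemma permutation_sigma0: "permutation (sigma0 G)"
  using sigma0_permutes finite_half_edges permutation_permutes by blast

lemma finite_vertices: "finite (vertices G)"
  using ribbon by (simp add: vertices_def cycles_on_def ribbon_graph_def)

lemma finite_edges: "finite (edges G)"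
  by (simp add: edges_def cycles_on_def finite_half_edges)

lemma orbit_sigma1: "h \<in> half_edges G \<Longrightarrow> orbit (sigma1 G) h = {h, sigma1 G h}"
proof -
  assume h: "h \<in> half_edges G"
  have "y \<in> {h, sigma1 G h}" if "y \<in> orbit (sigma1 G) h" for y
    using that by induction (auto simp: sigma1_sigma1 h)
  moreover have "h \<in> orbit (sigma1 G) h" "sigma1 G h \<in> orbit (sigma1 G) h"
    using sigma1_sigma1[OF h] by (metis orbit.base orbit.step)+
  ultimately show ?thesis by blast
qed

lemma edge_eq: "e \<in> edges G \<Longrightarrow> x \<in> e \<Longrightarrow> x \<in> half_edges G \<and> e = {x, sigma1 G x}"
  by (auto simp: edges_def cycles_on_def orbit_sigma1 sigma1_sigma1 sigma1_in)

lemma edgeE: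
  assumes "e \<in> edges G"
  obtains h where "h \<in> half_edges G" "e = {h, sigma1 G h}"
  using assms by (auto simp: edges_def cycles_on_def orbit_sigma1)

lemma Union_edges_subset: "A \<subseteq> edges G \<Longrightarrow> \<Union>A \<subseteq> half_edges G"
  using edge_eq by blast

lemma sigma1_in_Union: "A \<subseteq> edges G \<Longrightarrow> x \<in> \<Union>A \<Longrightarrow> sigma1 G x \<in> \<Union>A"
  using edge_eq by blast

lemma face_perm_permutes:
  assumes A: "A \<subseteq> edges G"
  shows "face_perm G A permutes half_edges G"
proof -
  define \<tau> where "\<tau> x = (if x \<in> \<Union>A then sigma1 G x else x)" for x
  have inv: "\<tau> (\<tau> x) = x" for x
    using sigma1_in_Union[OF A, of x] Union_edges_subset[OF A] sigma1_sigma1[of x]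
    by (auto simp: \<tau>_def)
  then have "bij \<tau>" by (intro bijI') metis+
  moreover have "\<tau> x = x" if "x \<notin> half_edges G" for x
    using that Union_edges_subset[OF A] by (auto simp: \<tau>_def)
  ultimately have "\<tau> permutes half_edges G"
    by (auto simp: permutes_def bij_iff)
  then have "sigma0 G \<circ> \<tau> permutes half_edges G"
    using sigma0_permutes by (rule permutes_compose)
  also have "sigma0 G \<circ> \<tau> = face_perm G A"
    by (auto simp: face_perm_def \<tau>_def)
  finally show ?thesis .
qed

text \<open>Neither end of the new edge belongs to an edge of \<open>A\<close>, so
  \<open>sigma1\<close> is not yet applied there; inserting the edge swaps exactly these two ends
  before \<open>sigma0\<close> acts.\<close>

lemma face_perm_insert:
  assumes A: "A \<subseteq> edges G" and h: "h \<in> half_edges G" and new: "{h, sigma1 G h} \<notin> A"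
  shows "face_perm G (insert {h, sigma1 G h} A) = face_perm G A \<circ> transpose h (sigma1 G h)"
proof -
  have "h \<notin> \<Union>A"
    using edge_eq A new by blast
  moreover have "sigma1 G h \<notin> \<Union>A"
    using sigma1_in_Union[OF A, of "sigma1 G h"] sigma1_sigma1[OF h] calculation by auto
  ultimately show ?thesis
    using sigma1_sigma1[OF h] sigma1_neq[OF h]
    by (auto simp: face_perm_def fun_eq_iff transpose_def)
qed

text \<open>Cycles of \<open>face_perm G A\<close> that meet \<open>\<Union>A\<close> correspond, by
  intersection with it, to the cycles after deletion. Those that miss it are cycles of
  \<open>sigma0\<close>, hence the isolated vertices that carry half-edges of \<open>G\<close>; the
  bare vertices are the remaining isolated ones.\<close>

lemma num_faces_eq:
  assumes A: "A \<subseteq> edges G"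
  shows "num_faces G A = card (cycles_on (face_perm G A) (half_edges G)) + card (bare_vertices G)"
proof -
  define D where "D = \<Union>A"
  let ?H = "half_edges G" and ?\<pi> = "face_perm G A"
  let ?F = "delete_outside (sigma0 G) D \<circ> delete_outside (sigma1 G) D"
  have DH: "D \<subseteq> ?H" using Union_edges_subset[OF A] by (simp add: D_def)
  have \<tau>D: "sigma1 G x \<in> D" if "x \<in> D" for x using sigma1_in_Union[OF A] that by (simp add: D_def)
  \<comment> \<open>\<open>D\<close> is a union of edges, so the next element of \<open>D\<close> on
    a cycle of \<open>sigma1\<close> is one step away.\<close>
  have del1: "delete_outside (sigma1 G) D x = sigma1 G x" if "x \<in> D" for x
  proof -
    have "(LEAST m. 0 < m \<and> (sigma1 G ^^ m) x \<in> D) = 1"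
      using \<tau>D[OF that] by (intro Least_equality) auto
    then show ?thesis using that by (simp add: delete_outside_def)
  qed
  have perm: "permutation ?\<pi>"
    using face_perm_permutes[OF A] finite_half_edges permutation_permutes by blast
  have \<pi>: "?\<pi> = (\<lambda>x. sigma0 G (if x \<in> D then delete_outside (sigma1 G) D x else x))"
    using del1 by (auto simp: face_perm_def D_def fun_eq_iff)
  have orbF: "orbit ?F h = orbit ?\<pi> h \<inter> D" if "h \<in> D" for h
    unfolding \<pi> by (rule orbit_delete_outside[OF permutation_sigma0 _ that]) (simp add: del1 \<tau>D)
  have orb_eq: "orbit ?\<pi> d = C" if "C \<in> cycles_on ?\<pi> ?H" "d \<in> C" for C d
    using that face_perm_permutes[OF A] finite_half_edges
    by (metis (no_types, lifting) cycles_on_def cyclic_on_orbit imageE orbit_cyclic_eq3)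
  have self: "x \<in> orbit ?\<pi> x" "x \<in> orbit (sigma0 G) x" for x
    by (rule permutation_self_in_orbit[OF perm], rule permutation_self_in_orbit[OF permutation_sigma0])
  have 1: "cycles_on ?F D = (\<lambda>C. C \<inter> D) ` {C \<in> cycles_on ?\<pi> ?H. C \<inter> D \<noteq> {}}" (is "_ = _ ` ?M")
  proof (intro set_eqI iffI)
    fix C assume "C \<in> cycles_on ?F D"
    then obtain d where d: "d \<in> D" "C = orbit ?\<pi> d \<inter> D" by (auto simp: cycles_on_def orbF)
    moreover have "orbit ?\<pi> d \<in> ?M" using d DH self by (auto simp: cycles_on_def)
    ultimately show "C \<in> (\<lambda>C. C \<inter> D) ` ?M" by blast
  next
    fix C assume "C \<in> (\<lambda>C. C \<inter> D) ` ?M"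
    then obtain C' d where "C = C' \<inter> D" "C' \<in> cycles_on ?\<pi> ?H" "d \<in> C'" "d \<in> D" by auto
    then show "C \<in> cycles_on ?F D" using orb_eq[of C' d] orbF[of d] by (auto simp: cycles_on_def)
  qed
  have 2: "inj_on (\<lambda>C. C \<inter> D) ?M"
  proof (rule inj_onI)
    fix C C' assume C: "C \<in> ?M" "C' \<in> ?M" "C \<inter> D = C' \<inter> D"
    then obtain d where "d \<in> C" "d \<in> C'" by auto
    then show "C = C'" using C(1,2) orb_eq[of C d] orb_eq[of C' d] by blast
  qed
  \<comment> \<open>Outside \<open>D\<close> the two permutations agree, so an orbit of either one
    that avoids \<open>D\<close> is an orbit of the other.\<close>
  have 3: "orbit (sigma0 G) h = orbit ?\<pi> h"
    if "orbit (sigma0 G) h \<inter> D = {} \<or> orbit ?\<pi> h \<inter> D = {}" for h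
    using that
  proof
    assume "orbit (sigma0 G) h \<inter> D = {}"
    then show ?thesis
      by (intro orbit_cong[symmetric]) (auto simp: self face_perm_def D_def)
  next
    assume "orbit ?\<pi> h \<inter> D = {}"
    then show ?thesis
      by (intro orbit_cong) (auto simp: self face_perm_def D_def)
  qed
  let ?N = "{C \<in> cycles_on ?\<pi> ?H. C \<inter> D = {}}"
  have "?N = {C \<in> cycles_on (sigma0 G) ?H. C \<inter> D = {}}"
    using 3 by (auto simp: cycles_on_def)
  then have "isolated_vertices G A = ?N <+> bare_vertices G"
    by (auto simp: isolated_vertices_def vertices_def half_edges_at_def D_def)
  moreover have fin: "finite (cycles_on ?\<pi> ?H)" by (simp add: cycles_on_def finite_half_edges)
  ultimately have "card (isolated_vertices G A) = card ?N + card (bare_vertices G)"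
    using ribbon by (simp add: card_Plus ribbon_graph_def)
  moreover have "card (cycles_on ?F D) = card ?M"
    unfolding 1 using 2 by (rule card_image)
  moreover have "card (cycles_on ?\<pi> ?H) = card ?N + card ?M"
    using fin by (subst card_Un_disjoint[symmetric]) (auto intro: arg_cong[where f = card])
  ultimately show ?thesis by (simp add: num_faces_def D_def)
qed

text \<open>The cycles of \<open>sigma0\<close> are disjoint and bare vertices carry no half-edges,
  so each half-edge determines its vertex.\<close>

lemma adjacency_eq:
  assumes A: "A \<subseteq> edges G"
  shows "adjacency G A = (\<lambda>h. (vertex_of G h, vertex_of G (sigma1 G h))) ` \<Union>A"
proof -
  have at: "v \<in> vertices G \<and> h \<in> half_edges_at v \<longleftrightarrow> v = vertex_of G h" if "h \<in> half_edges G" for h v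
  proof
    assume v: "v \<in> vertices G \<and> h \<in> half_edges_at v"
    then obtain x where x: "v = Inl (orbit (sigma0 G) x)" "h \<in> orbit (sigma0 G) x"
      by (auto simp: vertices_def half_edges_at_def cycles_on_def split: sum.splits)
    then have "orbit (sigma0 G) h = orbit (sigma0 G) x"
      using cyclic_on_orbit'[OF permutation_sigma0] orbit_cyclic_eq3 by metis
    with x show "v = vertex_of G h" by (simp add: vertex_of_def)
  next
    assume "v = vertex_of G h"
    with that permutation_self_in_orbit[OF permutation_sigma0]
    show "v \<in> vertices G \<and> h \<in> half_edges_at v"
      by (auto simp: vertices_def half_edges_at_def cycles_on_def vertex_of_def)
  qed
  show ?thesis
  proof (intro set_eqI iffI; clarify)
    fix u w assume "(u, w) \<in> adjacency G A"
    then obtain h where "h \<in> \<Union>A" "u \<in> vertices G" "w \<in> vertices G"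
        "h \<in> half_edges_at u" "sigma1 G h \<in> half_edges_at w"
      by (auto simp: adjacency_def)
    moreover from this have "h \<in> half_edges G" using Union_edges_subset[OF A] by blast
    ultimately show "(u, w) \<in> (\<lambda>h. (vertex_of G h, vertex_of G (sigma1 G h))) ` \<Union>A"
      using at[of h u] at[of "sigma1 G h" w] sigma1_in by blast
  next
    fix h e assume "h \<in> e" "e \<in> A"
    then have "h \<in> half_edges G" using Union_edges_subset[OF A] by blast
    then show "(vertex_of G h, vertex_of G (sigma1 G h)) \<in> adjacency G A"
      using at[of h "vertex_of G h"] at[of "sigma1 G h" "vertex_of G (sigma1 G h)"] sigma1_in
        \<open>h \<in> e\<close> \<open>e \<in> A\<close> by (auto simp: adjacency_def)
  qed
qed

lemma sym_adjacency:
  assumes A: "A \<subseteq> edges G"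
  shows "sym (adjacency G A)"
proof (rule symI)
  fix u w assume "(u, w) \<in> adjacency G A"
  then obtain h where h: "h \<in> \<Union>A" "u = vertex_of G h" "w = vertex_of G (sigma1 G h)"
    by (auto simp: adjacency_eq[OF A])
  have "sigma1 G h \<in> \<Union>A" "sigma1 G (sigma1 G h) = h"
    using sigma1_in_Union[OF A h(1)] Union_edges_subset[OF A] sigma1_sigma1 h(1) by blast+
  then show "(w, u) \<in> adjacency G A"
    unfolding adjacency_eq[OF A] h by (metis (no_types, lifting) image_eqI)
qed

lemma adjacency_insert:
  assumes "A \<subseteq> edges G" and h: "h \<in> half_edges G"
  defines "u \<equiv> vertex_of G h" and "w \<equiv> vertex_of G (sigma1 G h)"
  shows "adjacency G (insert {h, sigma1 G h} A) = adjacency G A \<union> {(u, w), (w, u)}"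
proof -
  have "{h, sigma1 G h} \<in> edges G"
    using h by (auto simp: edges_def cycles_on_def orbit_sigma1)
  then have "insert {h, sigma1 G h} A \<subseteq> edges G" using assms(1) by simp
  from adjacency_eq[OF this] adjacency_eq[OF assms(1)] show ?thesis
    by (auto simp: sigma1_sigma1[OF h] u_def w_def)
qed

lemma vertex_of_in: "h \<in> half_edges G \<Longrightarrow> vertex_of G h \<in> vertices G"
  by (auto simp: vertices_def vertex_of_def cycles_on_def)

text \<open>\<open>sigma0\<close> keeps the vertex and \<open>sigma1\<close> is applied only along
  edges of \<open>A\<close>, so walking along a face never leaves the component. Consequently an
  edge joining two components has its ends on different faces.\<close>

lemma face_in_component:
  assumes A: "A \<subseteq> edges G" and "x \<in> orbit (face_perm G A) h"
  shows "(vertex_of G h, vertex_of G x) \<in> (adjacency G A)\<^sup>*"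
proof -
  have "(vertex_of G x, vertex_of G (face_perm G A x)) \<in> (adjacency G A)\<^sup>*" for x
  proof -
    have "vertex_of G (sigma0 G y) = vertex_of G y" for y
      using permutation_orbit_step[OF permutation_sigma0] by (simp add: vertex_of_def)
    then show ?thesis
      unfolding face_perm_def adjacency_eq[OF A] by auto
  qed
  note step = this
  from assms(2) show ?thesis
    by induction (use step in \<open>auto intro: rtrancl_trans\<close>)
qed

text \<open>Adding an edge changes the number of faces by one, and joining two components
  always merges two faces; hence the Euler defect never drops and keeps its parity.\<close>

lemma Euler_defect:
  assumes "A \<subseteq> edges G"
  shows "even (2 * int (num_components G A) + int (card A) - int (num_vertices G) - int (num_faces G A))
    \<and> 0 \<le> 2 * int (num_components G A) + int (card A) - int (num_vertices G) - int (num_faces G A)"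
proof -
  from assms have "finite A" using finite_edges by (rule finite_subset)
  from this assms show ?thesis
  proof (induction rule: finite_induct)
    case empty
    \<comment> \<open>Without edges every vertex is its own component and an isolated vertex, so
      components, faces and vertices are equally many and the defect is 0.\<close>
    have "adjacency G {} = {}" by (simp add: adjacency_def)
    then have "components G {} = (\<lambda>v. {v}) ` vertices G"
      by (auto simp: components_def quotient_def)
    then have "num_components G {} = num_vertices G"
      by (simp add: num_components_def num_vertices_def card_image)
    moreover have "num_faces G {} = num_vertices G"
      by (simp add: num_faces_def isolated_vertices_def cycles_on_def num_vertices_def)
    ultimately show ?case by simp
  next
    case (insert e A)
    then have A: "A \<subseteq> edges G" and e: "e \<in> edges G" by auto
    from edgeE[OF e] obtain h where h: "h \<in> half_edges G" and eh: "e = {h, sigma1 G h}" .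
    let ?u = "vertex_of G h" and ?w = "vertex_of G (sigma1 G h)"
    have "components G (insert e A) = vertices G // (adjacency G A \<union> {(?u, ?w), (?w, ?u)})\<^sup>*"
      unfolding components_def eh adjacency_insert[OF A h] ..
    then have k: "num_components G (insert e A) + (if (?u, ?w) \<in> (adjacency G A)\<^sup>* then 0 else 1)
        = num_components G A"
      using card_quotient_insert_edge[OF finite_vertices sym_adjacency[OF A]
          vertex_of_in[OF h] vertex_of_in[OF sigma1_in[OF h]]]
      by (simp only: num_components_def components_def)
    have "face_perm G (insert e A) = face_perm G A \<circ> transpose h (sigma1 G h)"
      using face_perm_insert[OF A h] insert.hyps(2) eh by simp
    then have f: "int (num_faces G (insert e A)) =
        int (num_faces G A) + (if sigma1 G h \<in> orbit (face_perm G A) h then 1 else - 1)"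
      using num_faces_eq[OF A] num_faces_eq[OF insert.prems]
        card_cycles_on_transpose[OF face_perm_permutes[OF A] finite_half_edges h sigma1_in[OF h]]
        sigma1_neq[OF h] by simp
    have card: "card (insert e A) = Suc (card A)"
      using insert.hyps by simp
    note IH = insert.IH[OF A]
    show ?case
    proof (cases "sigma1 G h \<in> orbit (face_perm G A) h")
      \<comment> \<open>One face splits and no components are joined: edges and faces both grow by
        one, and the defect is unchanged.\<close>
      case True
      then have "(?u, ?w) \<in> (adjacency G A)\<^sup>*" by (rule face_in_component[OF A])
      with True k f card IH show ?thesis by simp blast
    next
      \<comment> \<open>Two faces merge. The defect grows by 2 if the ends were already connected;
        if two components are joined, their loss cancels this growth.\<close>
      case False
      with k f card show ?thesis using IH by (cases "(?u, ?w) \<in> (adjacency G A)\<^sup>*") auto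
    qed
  qed
qed

end

section \<open>Substitution homomorphisms and the field of fractions\<close>

definition is_ring_hom :: "('a::comm_ring_1 \<Rightarrow> 'b::comm_ring_1) \<Rightarrow> bool" where
  "is_ring_hom f \<longleftrightarrow> f 1 = 1 \<and> (\<forall>x y. f (x + y) = f x + f y) \<and> (\<forall>x y. f (x * y) = f x * f y)"

lemma is_ring_homD:
  assumes "is_ring_hom f"
  shows "f 0 = 0" "f 1 = 1" "f (x + y) = f x + f y" "f (x * y) = f x * f y" "f (x - y) = f x - f y"
    "f (x ^ n) = f x ^ n" "f (sum g A) = (\<Sum>a\<in>A. f (g a))"
proof -
  from assms have 1: "f 1 = 1" and add: "f (x + y) = f x + f y" and mult: "f (x * y) = f x * f y" for x y
    by (simp_all add: is_ring_hom_def)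
  have 0: "f 0 = 0" using add[of 0 0] by simp
  show "f 0 = 0" "f 1 = 1" "f (x + y) = f x + f y" "f (x * y) = f x * f y"
    by (fact 0 1 add mult)+
  show "f (x - y) = f x - f y" using add[of "x - y" y] by simp
  show "f (x ^ n) = f x ^ n" by (induction n) (simp_all add: 1 mult)
  show "f (sum g A) = (\<Sum>a\<in>A. f (g a))"
    by (induction A rule: infinite_finite_induct) (simp_all add: 0 add)
qed

text \<open>One layer of \<open>substitute3\<close>: map the coefficients, then evaluate. Three
  applications, starting from \<open>of_int\<close>, let the substitution pass through the sum over
  subgraphs.\<close>

lemma is_ring_hom_poly_map_poly:
  assumes f: "is_ring_hom f"
  shows "is_ring_hom (\<lambda>p. poly (map_poly f p) z)"
proof -
  note hom = is_ring_homD[OF f]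
  have "map_poly f (p + q) = map_poly f p + map_poly f q" for p q
    by (intro poly_eqI) (simp add: coeff_map_poly hom)
  moreover have "map_poly f (p * q) = map_poly f p * map_poly f q" for p q
    by (intro poly_eqI) (simp add: coeff_map_poly hom coeff_mult)
  ultimately show ?thesis by (simp add: is_ring_hom_def hom)
qed

lemma is_ring_hom_substitute3: "is_ring_hom (\<lambda>p. substitute3 p x y z)"
  unfolding substitute3_def
  by (intro is_ring_hom_poly_map_poly) (simp add: is_ring_hom_def)

lemma substitute3_vars:
  "substitute3 var_X x y z = x" "substitute3 var_Y x y z = y" "substitute3 var_Z x y z = z"
  by (simp_all add: substitute3_def var_X_def var_Y_def var_Z_def map_poly_pCons)

lemma to_fract_power: "to_fract (x ^ n) = to_fract x ^ n"
  by (induction n) simp_all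

lemma to_fract_monom_monom:
  "to_fract (monom (monom (1 :: int) g) n) = to_fract [:[:0, 1:]:] ^ g * to_fract [:0, 1:] ^ n"
proof -
  have "monom (monom (1 :: int) g) n = [:[:0, 1:]:] ^ g * [:0, 1:] ^ n"
    by (simp add: monom_altdef poly_const_pow)
  then show ?thesis by (simp only: to_fract_mult to_fract_power)
qed

section \<open>Contributions of the subgraphs to \<open>q_function\<close>\<close>

lemma num_components_pos:
  assumes G: "connected_ribbon_graph G"
  shows "vertices G \<noteq> {}" "num_components G A \<ge> 1"
proof -
  from G have rg: "ribbon_graph G" and "components G (edges G) \<noteq> {}"
    by (auto simp: connected_ribbon_graph_def num_components_def)
  then show V: "vertices G \<noteq> {}" by (auto simp: components_def quotient_def)
  have "components G A \<noteq> {}" "finite (components G A)"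
    using V finite_vertices[OF rg] by (auto simp: components_def quotient_def)
  then show "num_components G A \<ge> 1"
    by (simp add: num_components_def Suc_le_eq card_gt_0_iff)
qed

text \<open>Some vertex exists, so there is a half-edge, lying on a cycle of
  \<open>face_perm G A\<close>, or a bare vertex. This keeps the exponent
  \<open>num_faces G A - 1\<close> from being truncated.\<close>

lemma num_faces_pos:
  assumes G: "connected_ribbon_graph G" and A: "A \<subseteq> edges G"
  shows "num_faces G A \<ge> 1"
proof -
  from G have rg: "ribbon_graph G" by (simp add: connected_ribbon_graph_def)
  have "half_edges G \<noteq> {} \<or> bare_vertices G \<noteq> {}"
    using num_components_pos(1)[OF G] by (auto simp: vertices_def cycles_on_def)
  then have "card (cycles_on (face_perm G A) (half_edges G)) > 0 \<or> card (bare_vertices G) > 0"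
    using rg by (auto simp: ribbon_graph_def cycles_on_def card_gt_0_iff)
  then show ?thesis using num_faces_eq[OF rg A] by linarith
qed

text \<open>Parity in \<open>Euler_defect\<close> makes the division in \<open>genus\<close> exact.
  The second equation leaves nonnegative powers of Y once \<open>2 * genus\<close> factors are
  cancelled.\<close>

lemma connected_genus_nullity:
  assumes G: "connected_ribbon_graph G" and A: "A \<subseteq> edges G" and k: "num_components G A = 1"
  shows "genus G A \<ge> 0" "nat (nullity G A) = 2 * nat (genus G A) + (num_faces G A - 1)"
proof -
  have "ribbon_graph G" using G by (simp add: connected_ribbon_graph_def)
  from Euler_defect[OF this A]
  have ev: "even (int (num_components G A) + nullity G A - int (num_faces G A))"
    and nonneg: "0 \<le> int (num_components G A) + nullity G A - int (num_faces G A)"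
    by (simp_all add: nullity_def)
  from ev have "2 * genus G A = 1 + nullity G A - int (num_faces G A)"
    unfolding genus_def k by simp
  with nonneg num_faces_pos[OF G A] k
  show "genus G A \<ge> 0" "nat (nullity G A) = 2 * nat (genus G A) + (num_faces G A - 1)"
    by linarith+
qed

lemma q_function_eq:
  assumes G: "connected_ribbon_graph G"
  shows "q_function G =
    to_fract (\<Sum>A | A \<subseteq> edges G \<and> num_components G A = 1.
      monom (monom 1 (nat (genus G A))) (num_faces G A - 1))"
proof -
  from G have rg: "ribbon_graph G" and kG: "num_components G (edges G) = 1"
    by (simp_all add: connected_ribbon_graph_def)
  define t :: "int poly poly fract" where "t = to_fract [:[:0, 1:]:]"
  define Y :: "int poly poly fract" where "Y = to_fract [:0, 1:]"
  have Y: "Y \<noteq> 0" by (simp add: Y_def)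
  have hom: "is_ring_hom (\<lambda>p. substitute3 p 1 Y (t * inverse (Y ^ 2)))"
    by (rule is_ring_hom_substitute3)
  have "q_function G = substitute3 (BRT_polynomial G) 1 Y (t * inverse (Y ^ 2))"
    by (simp add: q_function_def t_def Y_def Let_def)
  \<comment> \<open>\<open>var_X - 1\<close> becomes 0, and connectedness of \<open>G\<close> puts 1
    for its number of components.\<close>
  also have "\<dots> = (\<Sum>A\<in>Pow (edges G). 0 ^ nat (int (num_components G A) - 1) *
      Y ^ nat (nullity G A) * (t * inverse (Y ^ 2)) ^ nat (genus G A))"
    by (simp add: BRT_polynomial_def is_ring_homD[OF hom] substitute3_vars kG)
  also have "\<dots> = (\<Sum>A | A \<subseteq> edges G \<and> num_components G A = 1.
      t ^ nat (genus G A) * Y ^ (num_faces G A - 1))"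
  proof (intro sum.mono_neutral_cong_right ballI)
    fix A assume "A \<in> Pow (edges G) - {A. A \<subseteq> edges G \<and> num_components G A = 1}"
    then have "num_components G A > 1"
      using num_components_pos(2)[OF G, of A] by auto
    then show "0 ^ nat (int (num_components G A) - 1) *
      Y ^ nat (nullity G A) * (t * inverse (Y ^ 2)) ^ nat (genus G A) = 0" by simp
  next
    fix A assume "A \<in> {A. A \<subseteq> edges G \<and> num_components G A = 1}"
    then have A: "A \<subseteq> edges G" "num_components G A = 1" by auto
    \<comment> \<open>The first factor is \<open>0 ^ 0 = 1\<close>, and since Y is nonzero the
      negative powers of Y from the genus cancel against the nullity.\<close>
    show "0 ^ nat (int (num_components G A) - 1) *
        Y ^ nat (nullity G A) * (t * inverse (Y ^ 2)) ^ nat (genus G A) =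
      t ^ nat (genus G A) * Y ^ (num_faces G A - 1)"
      using Y A(2) unfolding connected_genus_nullity(2)[OF G A]
      by (simp add: power_add power_mult power_mult_distrib power_inverse)
  qed (auto simp: finite_edges[OF rg])
  also have "\<dots> = to_fract (\<Sum>A | A \<subseteq> edges G \<and> num_components G A = 1.
      monom (monom 1 (nat (genus G A))) (num_faces G A - 1))"
    by (simp only: to_fract_sum to_fract_monom_monom t_def Y_def)
  finally show ?thesis .
qed

section \<open>Evaluation at Y = 0 and grouping by genus\<close>

theorem proposition2:
  fixes G :: "('a, 'v) ribbon"
  assumes "connected_ribbon_graph G"
  shows "\<exists>q :: int poly poly.
           to_fract q = q_function G \<and>
           poly q 0 = (\<Sum>j | num_quasi_trees_of_genus G j \<noteq> 0.
                         monom (int (num_quasi_trees_of_genus G j)) j) \<and>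
           poly (poly q 0) 1 = int (card (quasi_trees G))"
proof -
  let ?S = "{A. A \<subseteq> edges G \<and> num_components G A = 1}"
  let ?g = "\<lambda>A. nat (genus G A)"
  \<comment> \<open>The preimage found in \<open>q_function_eq\<close>: the inner exponent belongs
    to t, the outer one to Y.\<close>
  define q :: "int poly poly" where
    "q = (\<Sum>A\<in>?S. monom (monom 1 (?g A)) (num_faces G A - 1))"
  have rg: "ribbon_graph G" using assms by (simp add: connected_ribbon_graph_def)
  have finS: "finite ?S"
    using finite_edges[OF rg] by (auto intro: finite_subset[of _ "Pow (edges G)"])
  have QS: "quasi_trees G \<subseteq> ?S" by (auto simp: quasi_trees_def)
  then have finQ: "finite (quasi_trees G)" using finS by (rule finite_subset)
  \<comment> \<open>The factor \<open>0 ^ (num_faces G A - 1)\<close> is 1 for a single face and 0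
    for more.\<close>
  have q0: "poly q 0 = (\<Sum>A\<in>quasi_trees G. monom 1 (?g A))"
    unfolding q_def poly_sum poly_monom
  proof (intro sum.mono_neutral_cong_right ballI finS QS)
    fix A assume A: "A \<in> ?S - quasi_trees G"
    then have "num_faces G A \<ge> 1" "num_faces G A \<noteq> 1"
      using num_faces_pos[OF assms, of A] by (auto simp: quasi_trees_def)
    then show "monom 1 (?g A) * 0 ^ (num_faces G A - 1) = (0 :: int poly)" by simp
  qed (simp add: quasi_trees_def)
  \<comment> \<open>The genus is nonnegative here, so \<open>nat\<close> loses nothing.\<close>
  have num: "{A \<in> quasi_trees G. ?g A = j} = {A \<in> quasi_trees G. genus G A = int j}" for j
    using connected_genus_nullity(1)[OF assms] by (force simp: quasi_trees_def)
  \<comment> \<open>The index set of the sum over \<open>j\<close> is exactly the finite set of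
    occurring genera, so \<open>sum.group\<close> can collect the quasi-trees by genus.\<close>
  have supp: "{j. num_quasi_trees_of_genus G j \<noteq> 0} = ?g ` quasi_trees G"
    unfolding num_quasi_trees_of_genus_def num[symmetric] using finQ by auto
  have "(\<Sum>j | num_quasi_trees_of_genus G j \<noteq> 0. monom (int (num_quasi_trees_of_genus G j)) j)
      = (\<Sum>j\<in>?g ` quasi_trees G. \<Sum>A | A \<in> quasi_trees G \<and> ?g A = j. monom 1 (?g A))"
    unfolding supp
  proof (rule sum.cong[OF refl])
    fix j
    have "(\<Sum>A | A \<in> quasi_trees G \<and> ?g A = j. monom (1 :: int) (?g A)) =
        (\<Sum>A | A \<in> quasi_trees G \<and> ?g A = j. monom 1 j)"
      by (rule sum.cong) auto
    also have "\<dots> = monom (int (num_quasi_trees_of_genus G j)) j"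
      by (simp add: num num_quasi_trees_of_genus_def of_nat_monom mult_monom)
    finally show "monom (int (num_quasi_trees_of_genus G j)) j =
        (\<Sum>A | A \<in> quasi_trees G \<and> ?g A = j. monom 1 (?g A))" ..
  qed
  also have "\<dots> = poly q 0"
    unfolding q0 using finQ by (intro sum.group) auto
  finally have "poly q 0 =
      (\<Sum>j | num_quasi_trees_of_genus G j \<noteq> 0. monom (int (num_quasi_trees_of_genus G j)) j)" ..
  moreover have "poly (poly q 0) 1 = int (card (quasi_trees G))"
    by (simp add: q0 poly_sum poly_monom)
  moreover have "to_fract q = q_function G"
    unfolding q_def using q_function_eq[OF assms] ..
  ultimately show ?thesis by blast
qed

end
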